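(* For $n\ge 1$ let $f_n=|s^{-1}(\mathrm{Av}_n(231,312))|$ be the number of permutations $p$ of length $n$ such that $s(p)$ avoids both patterns $231$ and $312$, where $s$ is the stack sorting operation; set $f_0=0$. Let $a_n$ be the number of 0-1-trees on $n$ vertices for $n \ge 1$, and set $a_0=0$. Then the sequence $(f_n)$ satisfies the recurrence relation $$f_n=2f_{n-1}+2\sum_{i=2}^{n-1} f_{i-1}f_{n-i}\qquad (n\ge 2),$$ which is the same recurrence relation that is satisfied by $(a_n)$, namely $a_n=2a_{n-1}+2\sum_{i=2}^{n-1}a_{i-1}a_{n-i}$ for $n\ge 2$ with $a_1=1$. As $f_1=1$, this implies that $f_n=a_n$ for all $n$.
   Context: Stack sorting operation $s$: it is defined recursively on all finite permutations and their substrings (i.e. on finite strings of distinct positive integers) by $s(\varepsilon)=\varepsilon$ for the empty string $\varepsilon$, and, for a nonempty string $p=LmR$ where $m$ is the maximum entry of $p$, $L$ is the (possibly empty) string of entries to the left of $m$ and $R$ is the (possibly empty) string of entries to the right of $m$, by $s(p)=s(L)\,s(R)\,m$ (concatenation). Pattern avoidance: a permutation $p=p_1p_2\cdots p_n$ contains the pattern $q=q_1q_2\cdots q_k$ if there are indices $i_1<i_2<\cdots<i_k$ such that for all $r,t$, $p_{i_r}<p_{i_t}$ if and only if $q_r<q_t$; otherwise $p$ avoids $q$. $\mathrm{Av}_n(q,q')$ denotes the set of permutations of length $n$ (of $\{1,\dots,n\}$) that avoid both $q$ and $q'$, and $s^{-1}(\mathrm{Av}_n(q,q'))$ is the set of permutations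 $p$ of length $n$ with $s(p)\in \mathrm{Av}_n(q,q')$. 0-1-trees: a plane binary tree is a rooted plane tree on unlabeled vertices in which every non-leaf vertex has one or two children, and every child is a left child or a right child, even if it is the only child of its parent (so a vertex with only a left child is distinguished from a vertex with only a right child, and a vertex with two children has one left child and one right child). A 0-1-tree is a plane binary tree in which every vertex that has two children is labeled $0$ or $1$ (other vertices carry no label). *)

theory Defs
  imports "HOL-Combinatorics.Multiset_Permutations"
begin

text \<open>
  A permutation \<open>p\<^sub>1 p\<^sub>2 \<dots> p\<^sub>n\<close> of \<open>{1..n}\<close> is represented in one-line notation as a list, that is,
  as an element of \<^term>\<open>permutations_of_set {1..n::nat}\<close>; entries are indexed from 0.
\<close>

text \<open>
  On the intended arguments, lists with distinct entries, the maximum \<open>m\<close> occurs exactly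
  once, so the argument is \<open>L @ [m] @ R\<close> with \<open>L\<close> the part before and \<open>R\<close> the part after \<open>m\<close>.
\<close>

function stack_sort :: "nat list \<Rightarrow> nat list" where
  "stack_sort [] = []"
| "stack_sort (x # xs) =
     (let p = x # xs;
          m = Max (set p);
          L = takeWhile (\<lambda>y. y \<noteq> m) p;
          R = tl (dropWhile (\<lambda>y. y \<noteq> m) p)
      in stack_sort L @ stack_sort R @ [m])"
  by pat_completeness auto

termination
proof (relation "measure length", goal_cases)
  case 1
  show ?case by simp
next
  case (2 x xs p m L)
  have "m \<in> set p" using 2 Max_in[of "set p"] by auto
  then have "length (takeWhile (\<lambda>y. y \<noteq> m) p) < length p"
    by (induction p) auto
  then show ?case using 2 by simp
next
  case (3 x xs p m L R)
  have "length R \<le> length p - 1"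
    using 3 length_dropWhile_le[of "\<lambda>y. y \<noteq> m" p] by (simp del: dropWhile.simps)
  then show ?case using 3 by simp
qed

definition contains_pattern :: "nat list \<Rightarrow> nat list \<Rightarrow> bool" where
  "contains_pattern p q \<longleftrightarrow>
     (\<exists>idx :: nat \<Rightarrow> nat.
        strict_mono_on {..<length q} idx \<and>
        (\<forall>r<length q. idx r < length p) \<and>
        (\<forall>r<length q. \<forall>t<length q. p ! idx r < p ! idx t \<longleftrightarrow> q ! r < q ! t))"

definition Av :: "nat \<Rightarrow> nat list \<Rightarrow> nat list \<Rightarrow> nat list set" where
  "Av n q q' =
     {p \<in> permutations_of_set {1..n}. \<not> contains_pattern p q \<and> \<not> contains_pattern p q'}"

definition stack_sort_preimage :: "nat \<Rightarrow> nat list set \<Rightarrow> nat list set" where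
  "stack_sort_preimage n A = {p \<in> permutations_of_set {1..n}. stack_sort p \<in> A}"

definition f_seq :: "nat \<Rightarrow> nat" where
  "f_seq n = (if n = 0 then 0 else card (stack_sort_preimage n (Av n [2,3,1] [3,1,2])))"

text \<open>
  The empty tree is not a 0-1-tree. The constructors say which children the root has; only a
  root with two children carries a label, where \<^const>\<open>False\<close> stands for 0 and \<^const>\<open>True\<close> for 1.
\<close>

datatype zero_one_tree =
    Leaf
  | Left_Only zero_one_tree
  | Right_Only zero_one_tree
  | Two_Children bool zero_one_tree zero_one_tree

fun vertices :: "zero_one_tree \<Rightarrow> nat" where
  "vertices Leaf = 1"
| "vertices (Left_Only l) = 1 + vertices l"
| "vertices (Right_Only r) = 1 + vertices r"
| "vertices (Two_Children b l r) = 1 + vertices l + vertices r"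

definition a_seq :: "nat \<Rightarrow> nat" where
  "a_seq n = (if n = 0 then 0 else card {t. vertices t = n})"

end

theory Submission
  imports Defs "HOL-Library.Infinite_Set"
begin

text \<open>
  The permutations that avoid both 231 and 312 are the layered ones: increasing sequences of blocks
  of consecutive values, each block written decreasingly. They are also the permutations in which
  every descent \<open>a b\<close> is by one, that is, no entry has a value strictly between \<open>b\<close> and \<open>a\<close>
  (\<open>avoids_231_312_iff_gap_free\<close>). This condition speaks only of neighbouring entries, so it can
  be checked separately on two factors of a concatenation and at the place where they meet.

  Write \<open>p = L n R\<close> with \<open>n\<close> maximal. The last letter of \<open>s(p) = s(L) s(R) n\<close> cannot take part in
  either pattern, so the question is when \<open>s(L) s(R)\<close> is layered. If \<open>L\<close> or \<open>R\<close> is empty, the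
  other part is an arbitrary permutation counted by \<open>f\<close> at \<open>n - 1\<close>; this gives the term
  \<open>2 f(n - 1)\<close>.

  If both are nonempty, the decisive fact is that \<open>s(L)\<close> ends in its maximum \<open>M\<close>. A layered word
  can be cut in front of a new layer, and then all of \<open>L\<close> lies below all of \<open>R\<close>; or it can be cut
  inside a layer, and then the part of that layer in \<open>s(L)\<close> consists of \<open>M\<close> alone, while \<open>s(R)\<close>
  starts with \<open>M - 1\<close> and everything else in \<open>L\<close> lies below \<open>R\<close> (\<open>gap_free_append_iff\<close>). Each
  of the two possibilities realises every pair of relative orders counted by \<open>f\<close> exactly
  once. This is clear for the first. For the second, let \<open>R'\<close> be the copy of \<open>R\<close> on the largest values.
  Lowering the values of \<open>R'\<close> up to \<open>M\<close> by one recovers \<open>R\<close> and takes \<open>M\<close> to \<open>M - 1\<close>, so \<open>s(R)\<close>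
  starts with \<open>M - 1\<close> exactly if \<open>s(R')\<close> starts with \<open>M\<close>. Thus \<open>R'\<close> determines \<open>M\<close>, and summing
  over all \<open>M\<close> counts each \<open>R'\<close> once (\<open>card_split_pairs\<close>). Hence the lengths
  \<open>i - 1\<close> and \<open>n - i\<close> contribute \<open>2 f(i - 1) f(n - i)\<close>.

  For trees, removing the root gives the same recurrence: a single subtree can be a left or a right
  child, and two subtrees come with one of two labels.
\<close>

section \<open>Lists whose descents skip nothing\<close>

text \<open>
  The ambient set \<open>S\<close> is a parameter, rather than the set of entries of \<open>q\<close>, so that a
  factor of a word can be compared with the values of the whole word.
\<close>
definition gap_free :: "nat set \<Rightarrow> nat list \<Rightarrow> bool" where
  "gap_free S q \<longleftrightarrow> successively (\<lambda>a b. \<forall>c\<in>S. \<not> (b < c \<and> c < a)) q"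

lemma gap_free_simps [simp]:
  "gap_free S []"
  "gap_free S [a]"
  "gap_free S (a # b # q) \<longleftrightarrow> (\<forall>c\<in>S. \<not> (b < c \<and> c < a)) \<and> gap_free S (b # q)"
  by (simp_all add: gap_free_def)

lemma gap_free_append:
  "gap_free S (u @ v) \<longleftrightarrow> gap_free S u \<and> gap_free S v \<and>
     (u = [] \<or> v = [] \<or> (\<forall>c\<in>S. \<not> (hd v < c \<and> c < last u)))"
  by (auto simp: gap_free_def successively_append_iff)

lemma gap_free_mono: "gap_free S q \<Longrightarrow> T \<subseteq> S \<Longrightarrow> gap_free T q"
  unfolding gap_free_def by (erule successively_mono) auto

lemma gap_free_nth:
  "gap_free S q \<longleftrightarrow> (\<forall>i. Suc i < length q \<longrightarrow> (\<forall>c\<in>S. \<not> (q ! Suc i < c \<and> c < q ! i)))"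
  by (auto simp: gap_free_def successively_conv_nth)

text \<open>
  A discrete intermediate value property: since a descent never jumps over a value of \<open>S\<close>, the
  word can get from above \<open>c\<close> to below \<open>c\<close> only through \<open>c\<close> itself.
\<close>
lemma gap_free_stays_above:
  assumes "gap_free S q" "c \<in> S" "j \<le> k" "k < length q" "c < q ! j"
    and "\<And>i. j \<le> i \<Longrightarrow> i \<le> k \<Longrightarrow> q ! i \<noteq> c"
  shows "c < q ! k"
  using assms(3,4,6)
proof (induction k rule: dec_induct)
  case base
  then show ?case using assms(5) by simp
next
  case (step k)
  then have "c < q ! k" by simp
  moreover have "\<not> (q ! Suc k < c \<and> c < q ! k)"
    using assms(1,2) step.prems(1) by (auto simp: gap_free_nth)
  moreover have "q ! Suc k \<noteq> c" using step by simp
  ultimately show ?case by simp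
qed

lemma gap_free_all_above:
  assumes "gap_free S q" "c \<in> S" "c \<notin> set q" "q \<noteq> []" "c < hd q" "x \<in> set q"
  shows "c < x"
proof -
  obtain k where "k < length q" "q ! k = x" using assms(6) by (auto simp: in_set_conv_nth)
  moreover have "q ! i \<noteq> c" if "i \<le> k" for i using that \<open>k < length q\<close> assms(3) by auto
  ultimately show ?thesis
    using gap_free_stays_above[OF assms(1,2), of 0 k] assms(4,5) by (simp add: hd_conv_nth)
qed

lemma gap_free_map:
  assumes "strict_mono_on A f" "set q \<subseteq> A"
  shows "gap_free (f ` A) (map f q) \<longleftrightarrow> gap_free A q"
  using assms(2)
proof (induction q rule: induct_list012)
  case (3 x y q)
  have "f u < f v \<longleftrightarrow> u < v" if "u \<in> A" "v \<in> A" for u v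
    using strict_mono_on_less[OF assms(1) that] .
  then show ?case using 3 by auto
qed auto

lemma contains_pattern_231:
  "contains_pattern p [2,3,1] \<longleftrightarrow>
     (\<exists>i j k. i < j \<and> j < k \<and> k < length p \<and> p ! k < p ! i \<and> p ! i < p ! j)" (is "?l \<longleftrightarrow> ?r")
proof
  assume ?l
  then obtain idx where idx: "strict_mono_on {..<3} idx" "\<forall>r<3. idx r < length p"
    "\<forall>r<3. \<forall>t<3. p ! idx r < p ! idx t \<longleftrightarrow> [2,3,1::nat] ! r < [2,3,1] ! t"
    unfolding contains_pattern_def by (auto simp: numeral_3_eq_3)
  have "idx 0 < idx 1" "idx 1 < idx 2" using idx(1) by (auto intro: strict_mono_onD)
  moreover have "p ! idx 2 < p ! idx 0" "p ! idx 0 < p ! idx 1" using idx(3) by auto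
  ultimately show ?r using idx(2) by (metis numeral_less_iff semiring_norm(79) lessI numeral_3_eq_3 numeral_2_eq_2)
next
  assume ?r
  then obtain i j k where "i < j" "j < k" "k < length p" "p ! k < p ! i" "p ! i < p ! j" by blast
  then show ?l unfolding contains_pattern_def
    by (intro exI[of _ "(!) [i,j,k]"]) (auto simp: less_Suc_eq numeral_2_eq_2 strict_mono_on_def)
qed

lemma contains_pattern_312:
  "contains_pattern p [3,1,2] \<longleftrightarrow>
     (\<exists>i j k. i < j \<and> j < k \<and> k < length p \<and> p ! j < p ! k \<and> p ! k < p ! i)" (is "?l \<longleftrightarrow> ?r")
proof
  assume ?l
  then obtain idx where idx: "strict_mono_on {..<3} idx" "\<forall>r<3. idx r < length p"
    "\<forall>r<3. \<forall>t<3. p ! idx r < p ! idx t \<longleftrightarrow> [3,1,2::nat] ! r < [3,1,2] ! t"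
    unfolding contains_pattern_def by (auto simp: numeral_3_eq_3)
  have "idx 0 < idx 1" "idx 1 < idx 2" using idx(1) by (auto intro: strict_mono_onD)
  moreover have "p ! idx 1 < p ! idx 2" "p ! idx 2 < p ! idx 0" using idx(3) by auto
  ultimately show ?r using idx(2) by (metis numeral_less_iff semiring_norm(79) lessI numeral_3_eq_3 numeral_2_eq_2)
next
  assume ?r
  then obtain i j k where "i < j" "j < k" "k < length p" "p ! j < p ! k" "p ! k < p ! i" by blast
  then show ?l unfolding contains_pattern_def
    by (intro exI[of _ "(!) [i,j,k]"]) (auto simp: less_Suc_eq numeral_2_eq_2 strict_mono_on_def)
qed

text \<open>
  A descent that jumps over an entry \<open>c\<close> forms 231 with it if \<open>c\<close> stands before the descent and 312
  if \<open>c\<close> stands after it. Conversely, both patterns contain a large entry followed by a small one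
  with the middle value \<open>c\<close> outside the stretch between them, and that stretch would have to pass
  from above \<open>c\<close> to below \<open>c\<close> without meeting it.
\<close>
lemma avoids_231_312_iff_gap_free:
  assumes "distinct q"
  shows "\<not> contains_pattern q [2,3,1] \<and> \<not> contains_pattern q [3,1,2] \<longleftrightarrow> gap_free (set q) q"
    (is "?avoids \<longleftrightarrow> _")
proof
  assume avoids: ?avoids
  show "gap_free (set q) q"
    unfolding gap_free_nth
  proof (intro allI impI ballI notI)
    fix i c assume i: "Suc i < length q" and c: "c \<in> set q" "q ! Suc i < c \<and> c < q ! i"
    obtain j where j: "j < length q" "q ! j = c" using c(1) by (auto simp: in_set_conv_nth)
    then have "j \<noteq> i" "j \<noteq> Suc i" using c(2) by auto
    then consider "j < i" | "Suc i < j" by linarith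
    then show False
    proof cases
      case 1
      then have "contains_pattern q [2,3,1]"
        unfolding contains_pattern_231 using i j c(2) lessI by blast
      then show False using avoids by blast
    next
      case 2
      then have "contains_pattern q [3,1,2]"
        unfolding contains_pattern_312 using i j c(2) lessI by blast
      then show False using avoids by blast
    qed
  qed
next
  assume gf: "gap_free (set q) q"
  have crossing: False
    if "j < k" "k < length q" "q ! k < c" "c < q ! j" "i < length q" "q ! i = c" "i < j \<or> k < i"
    for i j k c
  proof -
    have "q ! l \<noteq> c" if "j \<le> l" "l \<le> k" for l
      using that \<open>k < length q\<close> \<open>i < length q\<close> \<open>q ! i = c\<close> \<open>i < j \<or> k < i\<close>
        nth_eq_iff_index_eq[OF assms, of l i] by auto
    then have "c < q ! k"
      using gap_free_stays_above[OF gf, of c j k] that by auto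
    then show False using \<open>q ! k < c\<close> by simp
  qed
  show ?avoids
    unfolding contains_pattern_231 contains_pattern_312
    by (meson crossing less_trans)
qed

section \<open>The stack sorting operation\<close>

lemma stack_sort_append:
  assumes "\<forall>x\<in>set L \<union> set R. x < m"
  shows "stack_sort (L @ m # R) = stack_sort L @ stack_sort R @ [m]"
proof -
  obtain x xs where p: "L @ m # R = x # xs" by (cases L) auto
  have "Max (set (x # xs)) = m"
    unfolding p[symmetric] using assms by (intro Max_eqI) (auto intro: less_imp_le)
  moreover have "\<forall>y\<in>set L. y \<noteq> m" using assms by auto
  then have "takeWhile (\<lambda>y. y \<noteq> m) (x # xs) = L" "dropWhile (\<lambda>y. y \<noteq> m) (x # xs) = m # R"
    unfolding p[symmetric] by (auto simp: takeWhile_append2 dropWhile_append2)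
  ultimately show ?thesis unfolding p by (simp add: Let_def del: takeWhile.simps dropWhile.simps)
qed

lemma split_at_maximum:
  fixes p :: "'a::linorder list"
  assumes "distinct p" "p \<noteq> []"
  obtains L R where "p = L @ Max (set p) # R" "\<forall>x\<in>set L \<union> set R. x < Max (set p)"
proof -
  have "Max (set p) \<in> set p" using assms by simp
  then obtain L R where p: "p = L @ Max (set p) # R" by (meson split_list)
  have "x < Max (set p)" if "x \<in> set L \<union> set R" for x
  proof -
    have "x \<in> set p" using that by (subst p) auto
    moreover have "distinct (L @ Max (set p) # R)" using assms(1) p by simp
    then have "x \<noteq> Max (set p)" using that by auto
    ultimately show ?thesis using Max_ge[of "set p" x] by (simp add: order_less_le)
  qed
  then show ?thesis using p that by blast
qed

text \<open>
  Induction along the recursion of the stack sorting operation.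
\<close>
lemma distinct_max_induct [consumes 1, case_names Nil split]:
  fixes p :: "'a::linorder list"
  assumes "distinct p"
    and "P []"
    and "\<And>L m R. distinct (L @ m # R) \<Longrightarrow> \<forall>x\<in>set L \<union> set R. x < m \<Longrightarrow> P L \<Longrightarrow> P R
           \<Longrightarrow> P (L @ m # R)"
  shows "P p"
  using assms(1)
proof (induction p rule: length_induct)
  case (1 p)
  show ?case
  proof (cases "p = []")
    case False
    then obtain L R where p: "p = L @ Max (set p) # R" "\<forall>x\<in>set L \<union> set R. x < Max (set p)"
      using split_at_maximum 1 by blast
    define m where "m = Max (set p)"
    have p': "p = L @ m # R" "\<forall>x\<in>set L \<union> set R. x < m" using p unfolding m_def by auto
    then show ?thesis using 1 assms(3)[of L m R] by simp
  qed (simp add: assms(2))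
qed

lemma set_stack_sort: "distinct p \<Longrightarrow> set (stack_sort p) = set p"
  by (induction p rule: distinct_max_induct) (auto simp: stack_sort_append)

lemma distinct_stack_sort: "distinct p \<Longrightarrow> distinct (stack_sort p)"
proof (induction p rule: distinct_max_induct)
  case (split L m R)
  then show ?case by (auto simp: stack_sort_append set_stack_sort)
qed simp

lemma last_stack_sort:
  assumes "distinct p" "p \<noteq> []"
  shows "last (stack_sort p) = Max (set p)"
proof -
  obtain L R where p: "p = L @ Max (set p) # R" "\<forall>x\<in>set L \<union> set R. x < Max (set p)"
    using split_at_maximum assms by blast
  then show ?thesis using stack_sort_append[OF p(2)] by simp
qed

lemma stack_sort_eq_Nil_iff: "distinct p \<Longrightarrow> stack_sort p = [] \<longleftrightarrow> p = []"
  using set_stack_sort[of p] by auto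

text \<open>
  Stack sorting depends only on the relative order of the entries.
\<close>
lemma stack_sort_map:
  assumes "distinct p" "strict_mono_on (set p) f"
  shows "stack_sort (map f p) = map f (stack_sort p)"
  using assms
proof (induction p rule: distinct_max_induct)
  case (split L m R)
  have "strict_mono_on (set L) f" "strict_mono_on (set R) f"
    using split.prems by (auto intro: monotone_on_subset)
  moreover have "\<forall>x\<in>set (map f L) \<union> set (map f R). x < f m"
    using split.prems split.hyps by (auto intro: strict_mono_onD)
  ultimately show ?case
    using split by (simp add: stack_sort_append)
qed simp

section \<open>Permutations with a gap-free image\<close>

definition gap_free_preimage :: "nat set \<Rightarrow> nat list set" where
  "gap_free_preimage A = {p \<in> permutations_of_set A. gap_free A (stack_sort p)}"

lemma mem_gap_free_preimage:
  "p \<in> gap_free_preimage A \<longleftrightarrow> set p = A \<and> distinct p \<and> gap_free A (stack_sort p)"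
  by (auto simp: gap_free_preimage_def permutations_of_set_def)

lemma finite_gap_free_preimage [simp]: "finite (gap_free_preimage A)"
  by (simp add: gap_free_preimage_def)

lemma disjoint_gap_free_preimage:
  "A \<noteq> B \<Longrightarrow> gap_free_preimage A \<inter> gap_free_preimage B = {}"
  by (auto simp: mem_gap_free_preimage)

lemma f_seq_eq: "n \<ge> 1 \<Longrightarrow> f_seq n = card (gap_free_preimage {1..n})"
proof -
  assume n: "n \<ge> 1"
  have "stack_sort_preimage n (Av n [2,3,1] [3,1,2]) = gap_free_preimage {1..n}"
  proof (rule set_eqI)
    fix p
    have "stack_sort p \<in> Av n [2,3,1] [3,1,2] \<longleftrightarrow> gap_free {1..n} (stack_sort p)"
      if "set p = {1..n}" "distinct p"
      using avoids_231_312_iff_gap_free[OF distinct_stack_sort[OF that(2)]] that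
      by (auto simp: Av_def permutations_of_set_def set_stack_sort distinct_stack_sort)
    then show "p \<in> stack_sort_preimage n (Av n [2,3,1] [3,1,2]) \<longleftrightarrow> p \<in> gap_free_preimage {1..n}"
      by (auto simp: stack_sort_preimage_def mem_gap_free_preimage permutations_of_set_def)
  qed
  then show ?thesis using n by (simp add: f_seq_def)
qed

text \<open>
  Relabelling along an order isomorphism, which allows counting on arbitrary finite sets of values.
\<close>
lemma map_gap_free_preimage:
  assumes "strict_mono_on A f"
  shows "gap_free_preimage (f ` A) = map f ` gap_free_preimage A"
proof -
  have inj: "inj_on f A" using assms by (rule strict_mono_on_imp_inj_on)
  have *: "map f p \<in> gap_free_preimage (f ` A) \<longleftrightarrow> p \<in> gap_free_preimage A" if "set p = A" for p
    using that inj assms gap_free_map[OF assms, of "stack_sort p"]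
    by (auto simp: mem_gap_free_preimage distinct_map stack_sort_map set_stack_sort)
  show ?thesis
  proof (intro set_eqI iffI)
    fix q assume q: "q \<in> gap_free_preimage (f ` A)"
    then have "set q = f ` A" by (simp add: mem_gap_free_preimage)
    define p where "p = map (the_inv_into A f) q"
    have "map f p = q" unfolding p_def map_map
      by (rule map_idI) (simp add: \<open>set q = f ` A\<close> f_the_inv_into_f[OF inj])
    moreover have "set p = A" unfolding p_def
      using inj by (simp add: \<open>set q = f ` A\<close> the_inv_into_onto)
    ultimately show "q \<in> map f ` gap_free_preimage A" using * q by blast
  next
    fix q assume "q \<in> map f ` gap_free_preimage A"
    then obtain p where p: "p \<in> gap_free_preimage A" "q = map f p" by blast
    then have "set p = A" by (simp add: mem_gap_free_preimage)
    then show "q \<in> gap_free_preimage (f ` A)" using * p by blast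
  qed
qed

lemma inj_on_map_gap_free_preimage:
  fixes f :: "nat \<Rightarrow> nat"
  assumes "strict_mono_on A f"
  shows "inj_on (map f) (gap_free_preimage A)"
proof (rule inj_on_mapI)
  have "\<Union> (set ` gap_free_preimage A) \<subseteq> A" by (auto simp: mem_gap_free_preimage)
  then show "inj_on f (\<Union> (set ` gap_free_preimage A))"
    using inj_on_subset[OF strict_mono_on_imp_inj_on[OF assms]] by blast
qed

lemma card_gap_free_preimage:
  assumes "finite A" "A \<noteq> {}"
  shows "card (gap_free_preimage A) = f_seq (card A)"
proof -
  obtain h where h: "bij_betw h {..<card A} A" "strict_mono_on {..<card A} h"
    using ex_bij_betw_strict_mono_card[OF assms(1)] .
  \<comment> \<open>The enumeration starts at 0, whereas permutations have the entries 1, 2, and so on.\<close>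
  define g where "g i = h (i - 1)" for i
  have g: "strict_mono_on {1..card A} g"
    unfolding g_def by (intro strict_mono_onI strict_mono_onD[OF h(2)]) auto
  have "g ` {1..card A} = h ` (\<lambda>i. i - 1) ` {1..card A}"
    by (simp add: g_def image_image)
  also have "(\<lambda>i. i - 1) ` {1..card A} = {..<card A}"
    by (auto simp: image_iff intro!: bexI[of _ "Suc _"])
  finally have "g ` {1..card A} = A" using h(1) by (simp add: bij_betw_def)
  moreover have "card A \<ge> 1" using assms by (simp add: Suc_leI card_gt_0_iff)
  ultimately show ?thesis
    using map_gap_free_preimage[OF g] card_image[OF inj_on_map_gap_free_preimage[OF g]] f_seq_eq
    by simp
qed

section \<open>Concatenating two gap-free lists\<close>

text \<open>
  In the application \<open>u\<close> and \<open>v\<close> are the images of the parts left and right of the maximum. The two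
  disjuncts are the two ways of cutting a layered word in front of a new layer or inside a layer.
  That \<open>u\<close> ends in its maximum leaves no other way: from \<open>hd v\<close> on, the word cannot sink below an
  entry of \<open>u\<close> that it starts above, and the junction forces all entries of \<open>u\<close> except possibly \<open>M\<close>
  to be below \<open>hd v\<close>.
\<close>
lemma gap_free_append_iff:
  assumes ne: "u \<noteq> []" "v \<noteq> []" and dist: "distinct (u @ v)" and M: "M = Max (set u)" "last u = M"
  shows "gap_free (set u \<union> set v) (u @ v) \<longleftrightarrow>
     gap_free (set u) u \<and> gap_free (set v) v \<and>
     ((\<forall>x\<in>set u. \<forall>y\<in>set v. x < y) \<or>
      hd v < M \<and> (\<forall>c\<in>set u \<union> set v. \<not> (hd v < c \<and> c < M)) \<and>
        (\<forall>x\<in>set u - {M}. \<forall>y\<in>set v. x < y))"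
    (is "gap_free ?S _ \<longleftrightarrow> _ \<and> _ \<and> (?sep \<or> ?linked)")
proof
  assume "gap_free ?S (u @ v)"
  then have gf: "gap_free ?S u" "gap_free ?S v" and junction: "\<forall>c\<in>?S. \<not> (hd v < c \<and> c < M)"
    using ne M by (auto simp: gap_free_append)
  have max: "x \<le> M" if "x \<in> set u" for x using that M by simp
  have mem: "M \<in> set u" "hd v \<in> set v" using ne M by auto
  have above: "c < y" if "c \<in> set u" "c < hd v" "y \<in> set v" for c y
    using gap_free_all_above[OF gf(2), of c y] that dist ne by auto
  have "?sep \<or> ?linked"
  proof (cases "M < hd v")
    case True
    then have ?sep using above max le_less_trans by blast
    then show ?thesis ..
  next
    case False
    moreover have "M \<noteq> hd v" using mem dist by auto
    ultimately have "hd v < M" by simp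
    moreover have "x < y" if "x \<in> set u - {M}" "y \<in> set v" for x y
    proof (rule above)
      have "x < M" using that max[of x] by auto
      then have "\<not> hd v < x" using that junction by blast
      moreover have "x \<noteq> hd v" using that mem dist by auto
      ultimately show "x < hd v" by simp
    qed (use that in auto)
    ultimately show ?thesis using junction by blast
  qed
  then show "gap_free (set u) u \<and> gap_free (set v) v \<and> (?sep \<or> ?linked)"
    using gf gap_free_mono by blast
next
  assume rhs: "gap_free (set u) u \<and> gap_free (set v) v \<and> (?sep \<or> ?linked)"
  then have gf: "gap_free (set u) u" "gap_free (set v) v" and cases: "?sep \<or> ?linked" by auto
  have below: "x < y" if "x \<in> set u" "x \<noteq> M" "y \<in> set v" for x y
    using cases that by auto
  have "gap_free ?S u"
    unfolding gap_free_nth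
  proof (intro allI impI ballI notI)
    fix i c assume i: "Suc i < length u" and c: "c \<in> ?S" "u ! Suc i < c \<and> c < u ! i"
    \<comment> \<open>The top of a descent in \<open>u\<close> is not \<open>M\<close>, which comes last, so it lies below all of \<open>v\<close>.\<close>
    have "last u = u ! (length u - 1)" using ne by (simp add: last_conv_nth)
    moreover have "i < length u" "length u - 1 < length u" "i \<noteq> length u - 1" using i by auto
    ultimately have "u ! i \<noteq> last u" using dist by (simp add: nth_eq_iff_index_eq)
    then have "u ! i < y" if "y \<in> set v" for y
      using below[of "u ! i" y] that i M(2) by simp
    then have "c \<in> set u" using c by fastforce
    then show False using gf(1) i c(2) by (auto simp: gap_free_nth)
  qed
  moreover have "gap_free ?S v"
    unfolding gap_free_nth
  proof (intro allI impI ballI notI)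
    fix i c assume i: "Suc i < length v" and c: "c \<in> ?S" "v ! Suc i < c \<and> c < v ! i"
    have no_gap: "\<not> (v ! Suc i < d \<and> d < v ! i)" if "d \<in> set v" for d
      using gf(2) i that by (auto simp: gap_free_nth)
    then have "c \<in> set u" using c by blast
    moreover have mem: "v ! Suc i \<in> set v" using i by simp
    ultimately have "c = M" using below[of c "v ! Suc i"] c(2) by fastforce
    have "\<not> ?sep" using \<open>c \<in> set u\<close> mem c(2) less_asym by blast
    then have link: "hd v < M" "\<not> (hd v < v ! Suc i \<and> v ! Suc i < M)"
      using cases mem by auto
    \<comment> \<open>Only \<open>M\<close> could be skipped. The bottom of the descent is not \<open>hd v\<close>, which comes first and
      lies directly below \<open>M\<close>, so the descent would also skip \<open>hd v\<close>.\<close>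
    have "v ! Suc i \<noteq> hd v"
      using dist ne i by (auto simp: hd_conv_nth nth_eq_iff_index_eq)
    then have "v ! Suc i < hd v" using link c(2) \<open>c = M\<close> by auto
    moreover have "hd v < v ! i" using link(1) c(2) \<open>c = M\<close> by simp
    ultimately show False using no_gap[of "hd v"] ne by simp
  qed
  moreover have "\<not> (hd v < c \<and> c < last u)" if "c \<in> ?S" for c
  proof (cases ?sep)
    case True
    then have "last u < hd v" using ne by simp
    then show ?thesis by simp
  next
    case False
    then show ?thesis using cases that M(2) by blast
  qed
  ultimately show "gap_free ?S (u @ v)" by (simp add: gap_free_append)
qed

section \<open>The recurrence for permutations\<close>

text \<open>
  The pairs \<open>(L, R)\<close> for which \<open>L (N + 1) R\<close> has a layered image, with the position of the maximum
  prescribed by \<open>m\<close>.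
\<close>
definition split_pairs :: "nat \<Rightarrow> nat \<Rightarrow> (nat list \<times> nat list) set" where
  "split_pairs m N = {(L, R). distinct (L @ R) \<and> set (L @ R) = {1..N} \<and> length L = m \<and>
     gap_free {1..N} (stack_sort L @ stack_sort R)}"

lemma finite_split_pairs [simp]: "finite (split_pairs m N)"
proof (rule finite_subset)
  let ?l = "{xs. set xs \<subseteq> {1..N} \<and> distinct xs}"
  show "split_pairs m N \<subseteq> ?l \<times> ?l" by (auto simp: split_pairs_def)
  show "finite (?l \<times> ?l)" by (intro finite_cartesian_product finite_subset_distinct) auto
qed

lemma gap_free_insert_upper:
  assumes "\<forall>x\<in>set q. x \<le> m"
  shows "gap_free (insert m S) q \<longleftrightarrow> gap_free S q"
proof -
  have "\<not> m < q ! i" if "Suc i < length q" for i using assms that by (simp add: not_less)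
  then show ?thesis by (auto simp: gap_free_nth)
qed

lemma gap_free_preimage_Suc:
  "gap_free_preimage {1..Suc N} = (\<lambda>(L, R). L @ Suc N # R) ` (\<Union>m\<in>{0..N}. split_pairs m N)"
proof -
  have *: "L @ Suc N # R \<in> gap_free_preimage {1..Suc N} \<longleftrightarrow> (L, R) \<in> split_pairs (length L) N"
    for L R
  proof -
    have perm: "set (L @ Suc N # R) = {1..Suc N} \<and> distinct (L @ Suc N # R) \<longleftrightarrow>
      set (L @ R) = {1..N} \<and> distinct (L @ R)"
    proof -
      have "{1..Suc N} = insert (Suc N) {1..N}" "Suc N \<notin> {1..N}" by auto
      moreover have "set (L @ Suc N # R) = insert (Suc N) (set (L @ R))" by auto
      moreover have "distinct (L @ Suc N # R) \<longleftrightarrow> distinct (L @ R) \<and> Suc N \<notin> set (L @ R)" by auto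
      ultimately show ?thesis by (metis insert_ident)
    qed
    have "gap_free {1..Suc N} (stack_sort (L @ Suc N # R)) \<longleftrightarrow>
        gap_free {1..N} (stack_sort L @ stack_sort R)"
      if p: "set (L @ R) = {1..N}" "distinct (L @ R)"
    proof -
      let ?w = "stack_sort L @ stack_sort R"
      have w: "set ?w = {1..N}" using p by (simp add: set_stack_sort)
      have "x < Suc N" if "x \<in> set L \<union> set R" for x
      proof -
        have "x \<in> {1..N}" using that p(1) by auto
        then show ?thesis by simp
      qed
      then have "stack_sort (L @ Suc N # R) = ?w @ [Suc N]" by (simp add: stack_sort_append)
      moreover have "gap_free {1..Suc N} (?w @ [Suc N]) \<longleftrightarrow> gap_free {1..Suc N} ?w"
        by (subst gap_free_append) auto
      moreover have "{1..Suc N} = insert (Suc N) {1..N}" by auto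
      moreover have "gap_free (insert (Suc N) {1..N}) ?w \<longleftrightarrow> gap_free {1..N} ?w"
        using w by (intro gap_free_insert_upper) auto
      ultimately show ?thesis by simp
    qed
    then show ?thesis using perm unfolding mem_gap_free_preimage split_pairs_def by auto
  qed
  have len: "length L \<le> N" if "(L, R) \<in> split_pairs m N" for L R m
  proof -
    have "card (set (L @ R)) = N" "distinct (L @ R)" using that by (auto simp: split_pairs_def)
    then have "length (L @ R) = N" using distinct_card by fastforce
    then show ?thesis by simp
  qed
  show ?thesis
  proof (intro set_eqI iffI)
    fix p assume p: "p \<in> gap_free_preimage {1..Suc N}"
    then have "Suc N \<in> set p" by (simp add: mem_gap_free_preimage)
    then obtain L R where "p = L @ Suc N # R" by (meson split_list)
    moreover from this have "(L, R) \<in> split_pairs (length L) N" using p * by simp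
    ultimately show "p \<in> (\<lambda>(L, R). L @ Suc N # R) ` (\<Union>m\<in>{0..N}. split_pairs m N)"
      using len by force
  next
    fix p assume "p \<in> (\<lambda>(L, R). L @ Suc N # R) ` (\<Union>m\<in>{0..N}. split_pairs m N)"
    then obtain L R m where "p = L @ Suc N # R" "(L, R) \<in> split_pairs m N" by auto
    moreover from this have "m = length L" by (simp add: split_pairs_def)
    ultimately show "p \<in> gap_free_preimage {1..Suc N}" using * by simp
  qed
qed

lemma card_gap_free_preimage_Suc:
  "card (gap_free_preimage {1..Suc N}) = (\<Sum>m=0..N. card (split_pairs m N))"
proof -
  have "inj_on (\<lambda>(L, R). L @ Suc N # R) (\<Union>m\<in>{0..N}. split_pairs m N)"
  proof (rule inj_onI, clarify)
    fix L R L' R' m m'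
    assume "(L, R) \<in> split_pairs m N" "(L', R') \<in> split_pairs m' N"
      and eq: "L @ Suc N # R = L' @ Suc N # R'"
    then have "set (L @ R) = {1..N}" "set (L' @ R') = {1..N}" by (auto simp: split_pairs_def)
    moreover have "Suc N \<notin> {1..N}" by simp
    ultimately have "Suc N \<notin> set (L @ R)" "Suc N \<notin> set (L' @ R')" by blast+
    then show "L = L' \<and> R = R'" using eq by (auto simp: append_Cons_eq_iff)
  qed
  then have "card (gap_free_preimage {1..Suc N}) = card (\<Union>m\<in>{0..N}. split_pairs m N)"
    unfolding gap_free_preimage_Suc by (rule card_image)
  also have "\<dots> = (\<Sum>m=0..N. card (split_pairs m N))"
  proof (rule card_UN_disjoint)
    show "\<forall>m\<in>{0..N}. \<forall>m'\<in>{0..N}. m \<noteq> m' \<longrightarrow> split_pairs m N \<inter> split_pairs m' N = {}"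
      by (auto simp: split_pairs_def)
  qed simp_all
  finally show ?thesis .
qed

lemma card_split_pairs_0: "N \<ge> 1 \<Longrightarrow> card (split_pairs 0 N) = f_seq N"
proof -
  assume "N \<ge> 1"
  moreover have "split_pairs 0 N = {[]} \<times> gap_free_preimage {1..N}"
    by (auto simp: split_pairs_def mem_gap_free_preimage)
  ultimately show ?thesis by (simp add: card_cartesian_product f_seq_eq)
qed

lemma card_split_pairs_self: "N \<ge> 1 \<Longrightarrow> card (split_pairs N N) = f_seq N"
proof -
  assume "N \<ge> 1"
  have "(L, R) \<in> split_pairs N N \<longleftrightarrow> L \<in> gap_free_preimage {1..N} \<and> R = []" for L R
  proof (cases "R = []")
    case True
    have "length L = N" if "distinct L" "set L = {1..N}"
      using that distinct_card[of L] by simp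
    then show ?thesis using True by (auto simp: split_pairs_def mem_gap_free_preimage)
  next
    case False
    have "length (L @ R) = N" if "distinct (L @ R)" "set (L @ R) = {1..N}"
      using that distinct_card[of "L @ R"] by simp
    then show ?thesis using False by (auto simp: split_pairs_def)
  qed
  then have "split_pairs N N = gap_free_preimage {1..N} \<times> {[]}" by auto
  then show ?thesis using \<open>N \<ge> 1\<close> by (simp add: card_cartesian_product f_seq_eq)
qed

text \<open>
  In the first case this determines the values of both parts from their lengths; in the second
  case it does so after \<open>M\<close> has been moved from the left to the right part.
\<close>
lemma separated_partition:
  fixes X Y :: "nat set"
  assumes "X \<union> Y = {1..N}" "\<forall>x\<in>X. \<forall>y\<in>Y. x < y"
  shows "X = {1..card X}" "Y = {Suc (card X)..N}"
proof -
  have fin: "finite X" using assms(1) by (metis finite_Un finite_atLeastAtMost)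
  show X: "X = {1..card X}"
  proof (cases "X = {}")
    case False
    define k where "k = Max X"
    have k: "k \<in> X" "\<forall>x\<in>X. x \<le> k" using fin False by (auto simp: k_def)
    have "X = {1..k}"
    proof (intro equalityI subsetI)
      fix x assume "x \<in> X"
      then have "x \<in> {1..N}" using assms(1) by blast
      then show "x \<in> {1..k}" using k \<open>x \<in> X\<close> by simp
    next
      fix x assume x: "x \<in> {1..k}"
      have "k \<in> {1..N}" using k assms(1) by blast
      then have "x \<in> X \<union> Y" using x assms(1) by auto
      then show "x \<in> X" using x k assms(2) by fastforce
    qed
    then show ?thesis by simp
  qed simp
  have "X \<inter> Y = {}" using assms(2) by blast
  then have "Y = {1..N} - {1..card X}" using assms(1) X by blast
  moreover have "{1..N} - {1..k} = {Suc k..N}" for k by auto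
  ultimately show "Y = {Suc (card X)..N}" by blast
qed

text \<open>
  Lowering the values up to \<open>M\<close> by one moves the missing value of an interval from its lower
  end \<open>m\<close> to \<open>M\<close>.
\<close>
lemma strict_mono_on_close_gap:
  "strict_mono_on {Suc m..N} (\<lambda>v. if v \<le> M then v - 1 else (v::nat))"
  by (auto simp: strict_mono_on_def)

lemma image_close_gap:
  assumes "M \<in> {Suc m..N}"
  shows "(\<lambda>v. if v \<le> M then v - 1 else v) ` {Suc m..N} = {m..N} - {M}"
proof (intro equalityI subsetI)
  fix x assume x: "x \<in> {m..N} - {M}"
  have "x = (\<lambda>v. if v \<le> M then v - 1 else v) (if x < M then Suc x else x)" using x by auto
  then show "x \<in> (\<lambda>v. if v \<le> M then v - 1 else v) ` {Suc m..N}"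
    by (rule image_eqI) (use x assms in auto)
qed (use assms in \<open>auto split: if_splits\<close>)

text \<open>
  This transports the condition that the right part continues the layer of \<open>M\<close> to a standard set of
  values that does not depend on \<open>M\<close>. There, different \<open>M\<close> select disjoint sets of permutations, and
  all of them together exhaust the count.
\<close>
lemma card_gap_free_preimage_hd:
  assumes "M \<in> {Suc m..N}"
  shows "card {R \<in> gap_free_preimage ({m..N} - {M}). hd (stack_sort R) = M - 1} =
         card {R \<in> gap_free_preimage {Suc m..N}. hd (stack_sort R) = M}"
proof -
  define g where "g v = (if v \<le> M then v - 1 else v)" for v :: nat
  note g = strict_mono_on_close_gap[of m N M, folded g_def]
  have "hd (stack_sort (map g R)) = M - 1 \<longleftrightarrow> hd (stack_sort R) = M"
    if "R \<in> gap_free_preimage {Suc m..N}" for R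
  proof -
    have R: "set R = {Suc m..N}" "distinct R" using that by (auto simp: mem_gap_free_preimage)
    then have "R \<noteq> []" using assms by auto
    then have ne: "stack_sort R \<noteq> []" using R by (simp add: stack_sort_eq_Nil_iff)
    then have "hd (stack_sort R) \<in> {Suc m..N}"
      using R set_stack_sort[of R] hd_in_set by blast
    moreover have "hd (stack_sort (map g R)) = g (hd (stack_sort R))"
      using R g ne by (simp add: stack_sort_map hd_map)
    ultimately show ?thesis using assms by (auto simp: g_def)
  qed
  then have "{R \<in> gap_free_preimage ({m..N} - {M}). hd (stack_sort R) = M - 1} =
     map g ` {R \<in> gap_free_preimage {Suc m..N}. hd (stack_sort R) = M}"
    unfolding image_close_gap[OF assms, symmetric] g_def[symmetric] map_gap_free_preimage[OF g]
    by blast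
  moreover have "inj_on (map g) {R \<in> gap_free_preimage {Suc m..N}. hd (stack_sort R) = M}"
    by (rule inj_on_subset[OF inj_on_map_gap_free_preimage[OF g]]) auto
  ultimately show ?thesis by (simp add: card_image)
qed

text \<open>
  The two cases of \<open>gap_free_append_iff\<close> with the sets of values made explicit. In the second
  case \<open>L\<close> consists of the least \<open>m - 1\<close> values and \<open>M\<close>, so \<open>M\<close> is the only freedom.
\<close>
lemma split_pairs_eq:
  assumes "1 \<le> m" "m < N"
  shows "split_pairs m N = gap_free_preimage {1..m} \<times> gap_free_preimage {Suc m..N} \<union>
    (\<Union>M\<in>{Suc m..N}. gap_free_preimage (insert M {1..<m}) \<times>
       {R \<in> gap_free_preimage ({m..N} - {M}). hd (stack_sort R) = M - 1})"
    (is "_ = ?sep \<union> ?linked")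
proof -
  have key: "gap_free {1..N} (stack_sort L @ stack_sort R) \<longleftrightarrow>
     gap_free (set L) (stack_sort L) \<and> gap_free (set R) (stack_sort R) \<and>
     ((\<forall>x\<in>set L. \<forall>y\<in>set R. x < y) \<or>
      hd (stack_sort R) < Max (set L) \<and>
      (\<forall>c\<in>{1..N}. \<not> (hd (stack_sort R) < c \<and> c < Max (set L))) \<and>
        (\<forall>x\<in>set L - {Max (set L)}. \<forall>y\<in>set R. x < y))"
    if "distinct (L @ R)" "set (L @ R) = {1..N}" "L \<noteq> []" "R \<noteq> []" for L R
  proof -
    have L: "distinct L" and R: "distinct R" and U: "set L \<union> set R = {1..N}" using that by auto
    have "distinct (stack_sort L @ stack_sort R)"
      using that(1) L R by (simp add: distinct_stack_sort set_stack_sort)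
    then show ?thesis
      using gap_free_append_iff[of "stack_sort L" "stack_sort R" "Max (set L)"] that(3,4)
      by (simp add: set_stack_sort L R U stack_sort_eq_Nil_iff last_stack_sort)
  qed
  have hd_mem: "hd (stack_sort R) \<in> set R" if "distinct R" "R \<noteq> []" for R
    using that by (metis hd_in_set set_stack_sort stack_sort_eq_Nil_iff)
  show ?thesis
  proof (intro equalityI subrelI)
    fix L R assume "(L, R) \<in> split_pairs m N"
    then have LR: "distinct (L @ R)" "set (L @ R) = {1..N}" and len: "length L = m"
      and gf: "gap_free {1..N} (stack_sort L @ stack_sort R)" by (auto simp: split_pairs_def)
    have L: "distinct L" "card (set L) = m" using LR(1) len by (auto simp: distinct_card)
    have "length (L @ R) = N" using LR distinct_card[of "L @ R"] by simp
    then have ne: "L \<noteq> []" "R \<noteq> []" using assms len by auto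
    define M where "M = Max (set L)"
    have M: "M \<in> set L" using ne by (simp add: M_def)
    note k = key[OF LR ne, folded M_def]
    have U: "set L \<union> set R = {1..N}" using LR(2) by simp
    from gf k consider (sep) "\<forall>x\<in>set L. \<forall>y\<in>set R. x < y"
      | (linked) "hd (stack_sort R) < M" "\<forall>c\<in>{1..N}. \<not> (hd (stack_sort R) < c \<and> c < M)"
          "\<forall>x\<in>set L - {M}. \<forall>y\<in>set R. x < y"
      by blast
    then show "(L, R) \<in> ?sep \<union> ?linked"
    proof cases
      case sep
      then have "set L = {1..m}" "set R = {Suc m..N}"
        using separated_partition[OF U sep] L by auto
      moreover from this have "L \<in> gap_free_preimage {1..m}" "R \<in> gap_free_preimage {Suc m..N}"
        using gf k LR(1) by (simp_all add: mem_gap_free_preimage)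
      ultimately show ?thesis by blast
    next
      case linked
      have h: "hd (stack_sort R) \<in> set R" using hd_mem LR(1) ne by simp
      have "hd (stack_sort R) = M - 1"
      proof (rule ccontr)
        assume "hd (stack_sort R) \<noteq> M - 1"
        then have "hd (stack_sort R) < M - 1" "M - 1 < M" using linked(1) by auto
        moreover have "M \<in> {1..N}" using M U by blast
        then have "M - 1 \<in> {1..N}" using calculation by auto
        ultimately show False using linked(2) by blast
      qed
      \<comment> \<open>With \<open>M\<close> moved to the right part, the two parts are separated.\<close>
      have sep': "\<forall>x\<in>set L - {M}. \<forall>y\<in>insert M (set R). x < y"
        using linked(3) by (auto simp: M_def order_less_le)
      have U': "(set L - {M}) \<union> insert M (set R) = {1..N}" using U M by blast
      have "card (set L - {M}) = m - 1" using L M by simp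
      then have parts: "set L - {M} = {1..m - 1}" "insert M (set R) = {Suc (m - 1)..N}"
        using separated_partition[OF U' sep'] by simp_all
      have "{1..m - 1} = {1..<m}" "Suc (m - 1) = m" using assms by auto
      moreover have "M \<notin> set R" using M LR(1) by auto
      ultimately have sets: "set L = insert M {1..<m}" "set R = {m..N} - {M}"
        using parts M by auto
      have "M \<in> {Suc (m - 1)..N}" using parts(2) by blast
      then have "M \<ge> m" "M \<le> N" using \<open>Suc (m - 1) = m\<close> by simp_all
      moreover have "M \<noteq> m"
      proof
        \<comment> \<open>The image of the right part would start with \<open>m - 1\<close>, which is below all its values.\<close>
        assume "M = m"
        then have "M - 1 \<in> {m..N}" using h sets \<open>hd (stack_sort R) = M - 1\<close> by simp
        then show False using \<open>M = m\<close> assms by auto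
      qed
      ultimately have "M \<in> {Suc m..N}" by simp
      moreover have "L \<in> gap_free_preimage (insert M {1..<m})"
        "R \<in> gap_free_preimage ({m..N} - {M})"
        using gf k LR(1) unfolding sets[symmetric] by (simp_all add: mem_gap_free_preimage)
      ultimately show ?thesis using \<open>hd (stack_sort R) = M - 1\<close> by blast
    qed
  next
    fix L R assume "(L, R) \<in> ?sep \<union> ?linked"
    then consider (sep) "L \<in> gap_free_preimage {1..m}" "R \<in> gap_free_preimage {Suc m..N}"
      | (linked) M where "M \<in> {Suc m..N}" "L \<in> gap_free_preimage (insert M {1..<m})"
          "R \<in> gap_free_preimage ({m..N} - {M})" "hd (stack_sort R) = M - 1"
      by blast
    then show "(L, R) \<in> split_pairs m N"
    proof cases
      case sep
      then have s: "set L = {1..m}" "set R = {Suc m..N}" "distinct L" "distinct R"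
        "gap_free (set L) (stack_sort L)" "gap_free (set R) (stack_sort R)"
        by (auto simp: mem_gap_free_preimage)
      have LR: "distinct (L @ R)" "set (L @ R) = {1..N}" using s assms by auto
      have "length L = m" using s distinct_card[of L] by simp
      moreover have ne: "L \<noteq> []" "R \<noteq> []" using s assms by auto
      ultimately show ?thesis using LR key[OF LR ne] s by (simp add: split_pairs_def)
    next
      case linked
      then have s: "set L = insert M {1..<m}" "set R = {m..N} - {M}" "distinct L" "distinct R"
        "gap_free (set L) (stack_sort L)" "gap_free (set R) (stack_sort R)"
        by (auto simp: mem_gap_free_preimage)
      have "insert M {1..<m} \<inter> ({m..N} - {M}) = {}" by auto
      then have "distinct (L @ R)" using s(1-4) by simp
      moreover have "insert M {1..<m} \<union> ({m..N} - {M}) = {1..N}" using assms linked(1) by auto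
      then have "set (L @ R) = {1..N}" by (simp only: set_append s(1,2))
      ultimately have LR: "distinct (L @ R)" "set (L @ R) = {1..N}" .
      have "card (insert M {1..<m}) = m" using assms linked(1) by simp
      then have len: "length L = m" using s(1,3) distinct_card[of L] by simp
      have "m \<in> set R" using s(2) assms linked(1) by simp
      then have ne: "L \<noteq> []" "R \<noteq> []" using s(1) by auto
      have max: "Max (set L) = M" unfolding s(1) using linked(1) by (intro Max_eqI) auto
      have "M - 1 < M" "\<forall>c\<in>{1..N}. \<not> (M - 1 < c \<and> c < M)" using linked(1) by auto
      moreover have "\<forall>x\<in>set L - {M}. \<forall>y\<in>set R. x < y" unfolding s(1,2) by auto
      ultimately have "gap_free {1..N} (stack_sort L @ stack_sort R)"
        unfolding key[OF LR ne] max linked(4) using s(5,6) by blast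
      then show ?thesis using LR len by (simp add: split_pairs_def)
    qed
  qed
qed

text \<open>
  The two families of pairs are equinumerous. In the second, the right parts for a given \<open>M\<close> are
  counted by the permutations of a fixed interval whose image starts with \<open>M\<close>; the image of any
  permutation of that interval starts with exactly one such \<open>M\<close>.
\<close>
lemma card_split_pairs:
  assumes "1 \<le> m" "m < N"
  shows "card (split_pairs m N) = 2 * (f_seq m * f_seq (N - m))"
proof -
  let ?G = gap_free_preimage
  let ?tail = "\<lambda>M. {R \<in> ?G ({m..N} - {M}). hd (stack_sort R) = M - 1}"
  let ?linked = "\<lambda>M. ?G (insert M {1..<m}) \<times> ?tail M"
  have sep: "card (?G {1..m} \<times> ?G {Suc m..N}) = f_seq m * f_seq (N - m)"
    using assms by (simp add: card_cartesian_product card_gap_free_preimage)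
  have head: "card (?G (insert M {1..<m})) = f_seq m" if "M \<in> {Suc m..N}" for M
    using that assms by (simp add: card_gap_free_preimage)
  have "(\<Sum>M\<in>{Suc m..N}. card (?tail M)) =
      (\<Sum>M\<in>{Suc m..N}. card {R \<in> ?G {Suc m..N}. hd (stack_sort R) = M})"
    by (intro sum.cong refl card_gap_free_preimage_hd)
  also have "\<dots> = card (\<Union>M\<in>{Suc m..N}. {R \<in> ?G {Suc m..N}. hd (stack_sort R) = M})"
    by (rule card_UN_disjoint[symmetric]) auto
  also have "(\<Union>M\<in>{Suc m..N}. {R \<in> ?G {Suc m..N}. hd (stack_sort R) = M}) = ?G {Suc m..N}"
  proof -
    have "hd (stack_sort R) \<in> {Suc m..N}" if "R \<in> ?G {Suc m..N}" for R
    proof -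
      have R: "distinct R" "set R = {Suc m..N}" using that by (auto simp: mem_gap_free_preimage)
      then have "R \<noteq> []" using assms by auto
      then show ?thesis using R by (metis hd_in_set set_stack_sort stack_sort_eq_Nil_iff)
    qed
    then show ?thesis by blast
  qed
  finally have tails: "(\<Sum>M\<in>{Suc m..N}. card (?tail M)) = f_seq (N - m)"
    using assms by (simp add: card_gap_free_preimage)
  have "card (\<Union>M\<in>{Suc m..N}. ?linked M) = (\<Sum>M\<in>{Suc m..N}. card (?linked M))"
  proof (rule card_UN_disjoint)
    show "\<forall>M\<in>{Suc m..N}. \<forall>M'\<in>{Suc m..N}. M \<noteq> M' \<longrightarrow> ?linked M \<inter> ?linked M' = {}"
    proof (intro ballI impI)
      fix M M' assume "M \<in> {Suc m..N}" "M' \<in> {Suc m..N}" "M \<noteq> M'"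
      then have "M \<in> insert M {1..<m}" "M \<notin> insert M' {1..<m}" by auto
      then have "insert M {1..<m} \<noteq> insert M' {1..<m}" by blast
      then show "?linked M \<inter> ?linked M' = {}"
        unfolding Times_Int_Times by (simp add: disjoint_gap_free_preimage)
    qed
  qed auto
  also have "\<dots> = (\<Sum>M\<in>{Suc m..N}. f_seq m * card (?tail M))"
    by (intro sum.cong refl) (simp only: card_cartesian_product head)
  also have "\<dots> = f_seq m * f_seq (N - m)"
    by (simp only: tails sum_distrib_left[symmetric])
  finally have linked: "card (\<Union>M\<in>{Suc m..N}. ?linked M) = f_seq m * f_seq (N - m)" .
  have "?G {1..m} \<times> ?G {Suc m..N} \<inter> (\<Union>M\<in>{Suc m..N}. ?linked M) = {}"
  proof -
    have "?G {1..m} \<times> ?G {Suc m..N} \<inter> ?linked M = {}" if "M \<in> {Suc m..N}" for M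
    proof -
      have "M \<notin> {1..m}" using that by simp
      then have "?G {1..m} \<inter> ?G (insert M {1..<m}) = {}"
        by (intro disjoint_gap_free_preimage) blast
      then show ?thesis by (simp only: Times_Int_Times Sigma_empty1)
    qed
    then show ?thesis by (simp only: Int_UN_distrib) simp
  qed
  then show ?thesis
    unfolding split_pairs_eq[OF assms]
    by (subst card_Un_disjoint) (use sep linked in auto)
qed

lemma sum_split_ends:
  fixes g :: "nat \<Rightarrow> nat"
  assumes "N \<ge> 1"
  shows "(\<Sum>m=0..N. g m) = g 0 + g N + (\<Sum>i=2..N. g (i - 1))"
proof -
  obtain K where N: "N = Suc K" using assms by (cases N) auto
  have "(\<Sum>i=2..N. g (i - 1)) = (\<Sum>m=1..K. g m)"
    unfolding N using sum.shift_bounds_cl_Suc_ivl[of "\<lambda>i. g (i - 1)" 1 K]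
    by (simp add: numeral_2_eq_2)
  moreover have "(\<Sum>m=0..N. g m) = g 0 + (\<Sum>m=1..K. g m) + g N"
    unfolding N by (simp add: sum.atLeast_Suc_atMost[of 0 K])
  ultimately show ?thesis by simp
qed

lemma f_seq_recurrence:
  assumes "n \<ge> 2"
  shows "f_seq n = 2 * f_seq (n - 1) + 2 * (\<Sum>i=2..n-1. f_seq (i - 1) * f_seq (n - i))"
proof -
  obtain N where n: "n = Suc N" "N \<ge> 1" using assms by (cases n) auto
  have "f_seq n = (\<Sum>m=0..N. card (split_pairs m N))"
    using f_seq_eq[of n] card_gap_free_preimage_Suc[of N] n by simp
  also have "\<dots> = 2 * f_seq N + (\<Sum>i=2..N. card (split_pairs (i - 1) N))"
    using n(2) by (simp add: sum_split_ends card_split_pairs_0 card_split_pairs_self)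
  also have "(\<Sum>i=2..N. card (split_pairs (i - 1) N)) =
      (\<Sum>i=2..N. 2 * (f_seq (i - 1) * f_seq (n - i)))"
    using n by (intro sum.cong refl) (subst card_split_pairs, auto simp: Suc_diff_le)
  finally show ?thesis using n by (simp add: sum_distrib_left)
qed

lemma f_seq_1: "f_seq 1 = 1"
proof -
  have "gap_free_preimage {1} = {[1]}"
    by (auto simp: gap_free_preimage_def)
  then show ?thesis using f_seq_eq[of 1] by simp
qed

section \<open>The recurrence for 0-1-trees\<close>

lemma vertices_pos: "vertices t \<ge> 1"
  by (cases t) auto

lemma trees_1: "{t. vertices t = 1} = {Leaf}"
proof -
  have "vertices t = 1 \<longleftrightarrow> t = Leaf" for t
  proof (cases t)
    case (Left_Only l)
    then show ?thesis using vertices_pos[of l] by simp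
  next
    case (Right_Only r)
    then show ?thesis using vertices_pos[of r] by simp
  next
    case (Two_Children b l r)
    then show ?thesis using vertices_pos[of l] by simp
  qed simp
  then show ?thesis by auto
qed

lemma trees_eq:
  assumes "n \<ge> 2"
  shows "{t. vertices t = n} =
    Left_Only ` {t. vertices t = n - 1} \<union> Right_Only ` {t. vertices t = n - 1} \<union>
    (\<Union>i\<in>{2..n-1}. (\<lambda>(b, l, r). Two_Children b l r) `
       (UNIV \<times> {t. vertices t = i - 1} \<times> {t. vertices t = n - i}))" (is "?l = ?r")
proof (intro equalityI subsetI)
  fix t assume t: "t \<in> ?l"
  show "t \<in> ?r"
  proof (cases t)
    case (Two_Children b l r)
    define i where "i = Suc (vertices l)"
    have "i \<in> {2..n-1}" "vertices l = i - 1" "vertices r = n - i"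
      using t Two_Children vertices_pos[of l] vertices_pos[of r] by (auto simp: i_def)
    then have "t \<in> (\<lambda>(b, l, r). Two_Children b l r) `
       (UNIV \<times> {t. vertices t = i - 1} \<times> {t. vertices t = n - i})"
      using Two_Children by (intro image_eqI[of _ _ "(b, l, r)"]) simp_all
    then show ?thesis using \<open>i \<in> {2..n-1}\<close> by blast
  qed (use t assms in auto)
qed (use assms in auto)

lemma finite_trees: "finite {t. vertices t = n}"
proof (induction n rule: less_induct)
  case (less n)
  consider "n = 0" | "n = 1" | "n \<ge> 2" by linarith
  then show ?case
  proof cases
    case 1
    then have "{t. vertices t = n} = {}" using vertices_pos by (auto simp: Suc_le_eq)
    then show ?thesis by simp
  next
    case 2
    then show ?thesis using trees_1 by simp
  next
    case 3
    have "finite {t. vertices t = n - 1}" using less 3 by simp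
    moreover have "finite {t. vertices t = i - 1}" "finite {t. vertices t = n - i}"
      if "i \<in> {2..n-1}" for i
    proof -
      have "i - 1 < n" "n - i < n" using that by auto
      then show "finite {t. vertices t = i - 1}" "finite {t. vertices t = n - i}"
        by (simp_all only: less)
    qed
    ultimately show ?thesis unfolding trees_eq[OF 3] by (auto intro!: finite_cartesian_product)
  qed
qed

lemma a_seq_eq: "n \<ge> 1 \<Longrightarrow> a_seq n = card {t. vertices t = n}"
  by (simp add: a_seq_def)

lemma a_seq_recurrence:
  assumes "n \<ge> 2"
  shows "a_seq n = 2 * a_seq (n - 1) + 2 * (\<Sum>i=2..n-1. a_seq (i - 1) * a_seq (n - i))"
proof -
  let ?T = "\<lambda>k. {t. vertices t = k}"
  let ?two = "\<lambda>i. (\<lambda>(b, l, r). Two_Children b l r) ` (UNIV \<times> ?T (i - 1) \<times> ?T (n - i))"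
  have card_two: "card (?two i) = 2 * (a_seq (i - 1) * a_seq (n - i))" if "i \<in> {2..n-1}" for i
  proof -
    have "card (?two i) = card ((UNIV :: bool set) \<times> ?T (i - 1) \<times> ?T (n - i))"
      by (rule card_image) (auto simp: inj_on_def)
    moreover have "i - 1 \<ge> 1" "n - i \<ge> 1" using that by auto
    ultimately show ?thesis by (simp only: card_cartesian_product a_seq_eq card_UNIV_bool)
  qed
  have "card (\<Union>i\<in>{2..n-1}. ?two i) = (\<Sum>i=2..n-1. card (?two i))"
    by (rule card_UN_disjoint) (auto simp: finite_trees)
  also have "\<dots> = 2 * (\<Sum>i=2..n-1. a_seq (i - 1) * a_seq (n - i))"
    unfolding sum_distrib_left by (intro sum.cong refl card_two)
  finally have two: "card (\<Union>i\<in>{2..n-1}. ?two i) =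
    2 * (\<Sum>i=2..n-1. a_seq (i - 1) * a_seq (n - i))" .
  have "card (Left_Only ` ?T (n - 1) \<union> Right_Only ` ?T (n - 1)) =
      card (Left_Only ` ?T (n - 1)) + card (Right_Only ` ?T (n - 1))"
    by (rule card_Un_disjoint) (auto simp: finite_trees)
  also have "\<dots> = 2 * a_seq (n - 1)"
    using assms by (simp add: card_image inj_on_def a_seq_eq)
  finally have one: "card (Left_Only ` ?T (n - 1) \<union> Right_Only ` ?T (n - 1)) = 2 * a_seq (n - 1)" .
  have "a_seq n = card ((Left_Only ` ?T (n - 1) \<union> Right_Only ` ?T (n - 1)) \<union>
      (\<Union>i\<in>{2..n-1}. ?two i))"
    using assms by (simp only: a_seq_eq[of n] trees_eq[OF assms])
  also have "\<dots> = card (Left_Only ` ?T (n - 1) \<union> Right_Only ` ?T (n - 1)) +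
      card (\<Union>i\<in>{2..n-1}. ?two i)"
    by (rule card_Un_disjoint) (auto simp: finite_trees)
  finally show ?thesis unfolding one two .
qed

lemma a_seq_1: "a_seq 1 = 1"
  unfolding a_seq_eq[OF order_refl] trees_1 by simp

section \<open>Equality of the two sequences\<close>

lemma f_seq_eq_a_seq: "f_seq n = a_seq n"
proof (induction n rule: less_induct)
  case (less n)
  consider "n = 0" | "n = 1" | "n \<ge> 2" by linarith
  then show ?case
  proof cases
    case 1
    then show ?thesis by (simp add: f_seq_def a_seq_def)
  next
    case 2
    then show ?thesis using f_seq_1 a_seq_1 by simp
  next
    case 3
    have "(\<Sum>i=2..n-1. f_seq (i - 1) * f_seq (n - i)) = (\<Sum>i=2..n-1. a_seq (i - 1) * a_seq (n - i))"
      using less by (intro sum.cong refl) auto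
    then show ?thesis
      using f_seq_recurrence[OF 3] a_seq_recurrence[OF 3] less[of "n - 1"] 3 by simp
  qed
qed

theorem theorem4p1:
  shows "(\<forall>n\<ge>2. f_seq n = 2 * f_seq (n - 1) + 2 * (\<Sum>i=2..n-1. f_seq (i - 1) * f_seq (n - i)))
       \<and> (\<forall>n\<ge>2. a_seq n = 2 * a_seq (n - 1) + 2 * (\<Sum>i=2..n-1. a_seq (i - 1) * a_seq (n - i)))
       \<and> f_seq 1 = 1 \<and> a_seq 1 = 1
       \<and> (\<forall>n. f_seq n = a_seq n)"
  using f_seq_recurrence a_seq_recurrence f_seq_1 a_seq_1 f_seq_eq_a_seq by blast

end
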